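(* Let $X$ be a locally compact Hausdorff space, $E$ a Banach lattice, and $\pi\colon C_0(X)\to\mathcal L_{\mathrm r}(E)$ a positive representation. (1) If $X$ is compact, and $E$ is not necessarily Dedekind complete, then: (a) $\|\pi(\phi)\|\leq\|\pi(\mathbf 1_X)\|\,(\|\phi_+\|+\|\phi_-\|)$ for all $\phi\in C_0(X)$, where $\phi_+$ and $\phi_-$ are the positive and negative parts of $\phi$. (b) $\pi\colon C_0(X)\to(\mathcal L_{\mathrm r}(E),\|\cdot\|)$ is bounded, and $\|\pi\|\leq2\|\pi(\mathbf 1_X)\|$. (2) If $X$ is not necessarily compact, and $E$ is Dedekind complete, then the maps $\pi\colon C_0(X)\to(\mathcal L_{\mathrm r}(E),\|\cdot\|)$ and $\pi\colon C_0(X)\to(\mathcal L_{\mathrm r}(E),\|\cdot\|_{\mathrm r})$ are both bounded, and $\|\pi\|\leq\|\pi\|_{\mathrm r}$. (3) If $X$ is compact, and $E$ is Dedekind complete, then $\pi\colon C_0(X)\to(\mathcal L_{\mathrm r}(E),\|\cdot\|)$ and $\pi\colon C_0(X)\to(\mathcal L_{\mathrm r}(E),\|\cdot\|_{\mathrm r})$ are both bounded, and $\|\pi\|=\|\pi\|_{\mathrm r}=\|\pi(\mathbf 1_X)\|$.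
   Context: All vector spaces are real. $C_0(X)$ is the Banach lattice algebra of real-valued continuous functions on $X$ vanishing at infinity with the supremum norm (all continuous functions if $X$ is compact), and $\mathbf 1_X$ is the constant function $1$. $\mathcal L(E)$ denotes the bounded linear operators on $E$ with operator norm $\|\cdot\|$, and $\mathcal L_{\mathrm r}(E)\subset\mathcal L(E)$ the regular operators (differences of two positive linear operators). If $E$ is Dedekind complete, $\|T\|_{\mathrm r}=\||T|\|$ is the regular norm on $\mathcal L_{\mathrm r}(E)$. For a linear map $\pi$ into $\mathcal L_{\mathrm r}(E)$, $\|\pi\|$ and $\|\pi\|_{\mathrm r}$ denote its norm when the codomain carries $\|\cdot\|$, resp. $\|\cdot\|_{\mathrm r}$. A positive representation of $C_0(X)$ on $E$ is an algebra homomorphism $\pi\colon C_0(X)\to\mathcal L(E)$ with $\pi(\phi)$ a positive operator for every $\phi\geq0$; it is not assumed bounded, unital or non-degenerate. *)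

theory Defs
  imports "HOL-Analysis.Analysis" "HOL-Library.Lattice_Algebras"
begin

section \<open>Banach lattices\<close>

class banach_lattice = banach + ordered_real_vector + lattice_ab_group_add_abs +
  assumes norm_mono_abs: "\<bar>x\<bar> \<le> \<bar>y\<bar> \<Longrightarrow> norm x \<le> norm y"

text \<open>A predicate on the type rather than a class, so that one statement can treat the same Banach
  lattice both with and without this assumption.\<close>

definition dedekind_complete :: "'e::banach_lattice itself \<Rightarrow> bool" where
  "dedekind_complete _ \<longleftrightarrow>
     (\<forall>S::'e set. S \<noteq> {} \<longrightarrow> bdd_above S \<longrightarrow>
        (\<exists>s. (\<forall>x\<in>S. x \<le> s) \<and> (\<forall>u. (\<forall>x\<in>S. x \<le> u) \<longrightarrow> s \<le> u)))"


section \<open>Regular operators\<close>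

definition positive_operator :: "('e::banach_lattice \<Rightarrow> 'e) \<Rightarrow> bool" where
  "positive_operator A \<longleftrightarrow> linear A \<and> (\<forall>x\<ge>0. 0 \<le> A x)"

text \<open>The positive operators \<open>A\<close> and \<open>B\<close> are not required to be bounded: positive linear operators
  on a Banach lattice are bounded automatically, so the type of \<open>T\<close> excludes nothing.\<close>

definition regular_operators :: "('e::banach_lattice \<Rightarrow>\<^sub>L 'e) set" where
  "regular_operators =
     {T. \<exists>A B. positive_operator A \<and> positive_operator B \<and> (\<forall>x. blinfun_apply T x = A x - B x)}"

definition operator_le :: "('e::banach_lattice \<Rightarrow>\<^sub>L 'e) \<Rightarrow> ('e \<Rightarrow>\<^sub>L 'e) \<Rightarrow> bool" where
  "operator_le S T \<longleftrightarrow> positive_operator (blinfun_apply (T - S))"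

text \<open>The modulus is the supremum of \<open>T\<close> and \<open>- T\<close> in the ordered vector space of regular operators.
  It is unique if it exists; it exists for every regular \<open>T\<close> if the lattice is Dedekind complete, and
  the definition is meaningful only then.\<close>

definition operator_modulus :: "('e::banach_lattice \<Rightarrow>\<^sub>L 'e) \<Rightarrow> ('e \<Rightarrow>\<^sub>L 'e)" where
  "operator_modulus T =
     (THE R. R \<in> regular_operators \<and> operator_le T R \<and> operator_le (- T) R \<and>
        (\<forall>S\<in>regular_operators. operator_le T S \<longrightarrow> operator_le (- T) S \<longrightarrow> operator_le R S))"

definition regular_norm :: "('e::banach_lattice \<Rightarrow>\<^sub>L 'e) \<Rightarrow> real" where
  "regular_norm T = norm (operator_modulus T)"


section \<open>Continuous functions vanishing at infinity\<close>

text \<open>A function on the space is represented by its extension by zero to the ambient type. The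
  algebra and lattice operations are then the pointwise ones, the constant function one is the
  indicator function of \<open>topspace X\<close>, and the supremum over the whole type below is the supremum
  over \<open>topspace X\<close> (and zero if \<open>X\<close> is empty).\<close>

definition C0 :: "'x topology \<Rightarrow> ('x \<Rightarrow> real) set" where
  "C0 X = {\<phi>. continuous_map X euclideanreal \<phi> \<and>
              (\<forall>x. x \<notin> topspace X \<longrightarrow> \<phi> x = 0) \<and>
              (\<forall>\<epsilon>>0. compactin X {x \<in> topspace X. \<epsilon> \<le> \<bar>\<phi> x\<bar>})}"

lemma C0_compact_space:
  assumes "compact_space X"
  shows "C0 X = {\<phi>. continuous_map X euclideanreal \<phi> \<and> (\<forall>x. x \<notin> topspace X \<longrightarrow> \<phi> x = 0)}"
proof -
  have "compactin X {x \<in> topspace X. \<epsilon> \<le> \<bar>\<phi> x\<bar>}"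
    if "continuous_map X euclideanreal \<phi>" for \<phi> and \<epsilon> :: real
  proof -
    have "continuous_map X euclideanreal (\<lambda>x. \<bar>\<phi> x\<bar>)"
      using that by (rule continuous_map_real_abs)
    then have "closedin X {x \<in> topspace X. \<bar>\<phi> x\<bar> \<in> {\<epsilon>..}}"
      by (rule closedin_continuous_map_preimage) simp
    then show ?thesis
      using assms by (simp add: closedin_compact_space)
  qed
  then show ?thesis
    by (auto simp: C0_def)
qed

definition sup_norm :: "('x \<Rightarrow> real) \<Rightarrow> real" where
  "sup_norm \<phi> = (SUP x. \<bar>\<phi> x\<bar>)"

abbreviation one_fun :: "'x topology \<Rightarrow> 'x \<Rightarrow> real" where
  "one_fun X \<equiv> indicator (topspace X)"

definition pos_part :: "('x \<Rightarrow> real) \<Rightarrow> 'x \<Rightarrow> real" where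
  "pos_part \<phi> = (\<lambda>x. max (\<phi> x) 0)"

definition neg_part :: "('x \<Rightarrow> real) \<Rightarrow> 'x \<Rightarrow> real" where
  "neg_part \<phi> = (\<lambda>x. max (- \<phi> x) 0)"


section \<open>Positive representations\<close>

text \<open>Only the values of \<open>\<pi>\<close> on \<open>C0 X\<close> matter.\<close>

definition positive_representation ::
    "'x topology \<Rightarrow> (('x \<Rightarrow> real) \<Rightarrow> ('e::banach_lattice \<Rightarrow>\<^sub>L 'e)) \<Rightarrow> bool" where
  "positive_representation X \<pi> \<longleftrightarrow>
     (\<forall>\<phi>\<in>C0 X. \<forall>\<psi>\<in>C0 X. \<pi> (\<lambda>x. \<phi> x + \<psi> x) = \<pi> \<phi> + \<pi> \<psi>) \<and>
     (\<forall>c. \<forall>\<phi>\<in>C0 X. \<pi> (\<lambda>x. c * \<phi> x) = c *\<^sub>R \<pi> \<phi>) \<and>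
     (\<forall>\<phi>\<in>C0 X. \<forall>\<psi>\<in>C0 X. \<pi> (\<lambda>x. \<phi> x * \<psi> x) = \<pi> \<phi> o\<^sub>L \<pi> \<psi>) \<and>
     (\<forall>\<phi>\<in>C0 X. (\<forall>x. 0 \<le> \<phi> x) \<longrightarrow> positive_operator (blinfun_apply (\<pi> \<phi>)))"

text \<open>The argument \<open>\<nu>\<close> is the norm on the codomain: \<open>norm\<close> is the operator norm and
  \<open>regular_norm\<close> the regular norm. The real number \<open>map_norm \<nu> X \<pi>\<close> is the norm of \<open>\<pi>\<close> only
  if \<open>bounded_map \<nu> X \<pi>\<close> holds, since a supremum in the reals is otherwise unspecified.\<close>

definition bounded_map ::
    "(('e::banach_lattice \<Rightarrow>\<^sub>L 'e) \<Rightarrow> real) \<Rightarrow> 'x topology \<Rightarrow> (('x \<Rightarrow> real) \<Rightarrow> ('e \<Rightarrow>\<^sub>L 'e)) \<Rightarrow> bool" where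
  "bounded_map \<nu> X \<pi> \<longleftrightarrow> (\<exists>M. \<forall>\<phi>\<in>C0 X. \<nu> (\<pi> \<phi>) \<le> M * sup_norm \<phi>)"

definition map_norm ::
    "(('e::banach_lattice \<Rightarrow>\<^sub>L 'e) \<Rightarrow> real) \<Rightarrow> 'x topology \<Rightarrow> (('x \<Rightarrow> real) \<Rightarrow> ('e \<Rightarrow>\<^sub>L 'e)) \<Rightarrow> real" where
  "map_norm \<nu> X \<pi> = (SUP \<phi>\<in>{\<phi> \<in> C0 X. sup_norm \<phi> \<le> 1}. \<nu> (\<pi> \<phi>))"

end

theory Submission
  imports Defs
begin

text \<open>A positive map is dominated by its values on absolute values: \<open>- \<pi> \<bar>\<phi>\<bar> \<le> \<pi> \<phi> \<le> \<pi> \<bar>\<phi>\<bar>\<close>, hence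
  \<open>\<bar>\<pi> \<phi> x\<bar> \<le> \<pi> \<bar>\<phi>\<bar> \<bar>x\<bar>\<close> and \<open>norm (\<pi> \<phi>) \<le> norm (\<pi> \<bar>\<phi>\<bar>)\<close>; if \<open>E\<close> is Dedekind complete, the regular
  norm of \<open>\<pi> \<phi>\<close> lies between the two. In the compact case \<open>\<bar>\<phi>\<bar>\<close> is at most its sup norm
  times the constant function one, which already gives \<open>norm (\<pi> \<phi>) \<le> norm (\<pi> 1) * sup_norm \<phi>\<close>,
  with or without Dedekind completeness. In general, boundedness on the positive cone of \<open>C0 X\<close>
  follows from its completeness.\<close>

section \<open>Dominated operators and their moduli\<close>

lemma norm_abs_banach_lattice [simp]: "norm \<bar>x\<bar> = norm (x::'e::banach_lattice)"
  by (intro antisym norm_mono_abs) simp_all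

lemma operator_le_iff: "operator_le S T \<longleftrightarrow> (\<forall>x\<ge>0. blinfun_apply S x \<le> blinfun_apply T x)"
  by (simp add: operator_le_def positive_operator_def blinfun.diff_left
      bounded_linear.linear blinfun.bounded_linear_right)

lemma operator_le_antisym:
  assumes "operator_le S T" "operator_le T S"
  shows "S = T"
proof (rule blinfun_eqI)
  fix x
  have eq: "S y = T y" if "0 \<le> y" for y
    using assms that by (auto simp: operator_le_iff intro: antisym)
  have "S (pprt x) + S (nprt x) = T (pprt x) + T (nprt x)"
    using eq[of "pprt x"] eq[of "- nprt x"] by (simp add: blinfun.minus_right)
  then show "S x = T x"
    by (simp flip: blinfun.add_right prts)
qed

text \<open>On the cone \<open>P x\<close> lies above both \<open>T x\<close> and
  \<open>- T x\<close>, hence above \<open>\<bar>T x\<bar>\<close>. So every operator competing for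
  the modulus of \<open>T\<close> is positive, and therefore regular.\<close>

lemma operator_le_dominated_imp_positive:
  assumes "operator_le T P" "operator_le (- T) P"
  shows "positive_operator (blinfun_apply P)"
proof -
  have "0 \<le> P x" if "0 \<le> x" for x
  proof -
    have "T x \<le> P x" "- T x \<le> P x"
      using assms that by (auto simp: operator_le_iff blinfun.minus_left)
    then show ?thesis
      using abs_ge_zero[of "T x"] abs_leI[of "T x" "P x"] order_trans by blast
  qed
  then show ?thesis
    by (simp add: positive_operator_def bounded_linear.linear blinfun.bounded_linear_right)
qed

lemma positive_operator_mono:
  assumes "positive_operator A" "x \<le> y"
  shows "A x \<le> A y"
  using assms unfolding positive_operator_def
  by (metis diff_ge_0_iff_ge linear_diff)

text \<open>Passes from the cone to arbitrary \<open>x\<close> by splitting into positive and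
  negative parts. Here \<open>nprt x\<close> is nonpositive, so the negative part is
  \<open>- nprt x\<close>.\<close>

lemma abs_dominated_apply_le:
  assumes "operator_le T P" "operator_le (- T) P"
  shows "\<bar>blinfun_apply T x\<bar> \<le> blinfun_apply P \<bar>x\<bar>"
proof -
  have P: "\<bar>T y\<bar> \<le> P y" if "0 \<le> y" for y
    using assms that by (auto simp: operator_le_iff blinfun.minus_left intro: abs_leI)
  have "T x = T (pprt x) - T (- nprt x)"
    by (simp add: blinfun.minus_right flip: blinfun.add_right prts)
  also have "\<bar>\<dots>\<bar> \<le> \<bar>T (pprt x)\<bar> + \<bar>T (- nprt x)\<bar>"
    by (rule abs_triangle_ineq4)
  also have "\<dots> \<le> P (pprt x) + P (- nprt x)"
    by (intro add_mono P) simp_all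
  also have "\<dots> = P \<bar>x\<bar>"
    by (simp add: abs_prts blinfun.minus_right blinfun.diff_right)
  finally show ?thesis .
qed

lemma norm_dominated_le:
  assumes "operator_le T P" "operator_le (- T) P"
  shows "norm T \<le> norm P"
proof (rule norm_blinfun_bound)
  fix x
  \<comment> \<open>The outer absolute value is there because \<open>norm_mono_abs\<close> compares
    absolute values.\<close>
  have "\<bar>T x\<bar> \<le> \<bar>P \<bar>x\<bar>\<bar>"
    using abs_dominated_apply_le[OF assms, of x] abs_ge_self order_trans by blast
  then have "norm (T x) \<le> norm (P \<bar>x\<bar>)"
    by (rule norm_mono_abs)
  also have "\<dots> \<le> norm P * norm x"
    using norm_blinfun[of P "\<bar>x\<bar>"] by simp
  finally show "norm (T x) \<le> norm P * norm x" .
qed simp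

text \<open>Truncate \<open>y\<close> to the order interval from \<open>- a\<close> to
  \<open>a\<close>; since \<open>y\<close> lies between \<open>- (a + b)\<close> and
  \<open>a + b\<close>, what is cut off lies between \<open>- b\<close> and \<open>b\<close>. This
  will give subadditivity in the Riesz-Kantorovich formula.\<close>

lemma riesz_decomposition_abs:
  fixes y :: "'e::banach_lattice"
  assumes "\<bar>y\<bar> \<le> a + b" "0 \<le> a" "0 \<le> b"
  obtains y1 y2 where "y = y1 + y2" "\<bar>y1\<bar> \<le> a" "\<bar>y2\<bar> \<le> b"
proof
  define y1 where "y1 = sup (- a) (inf y a)"
  have y: "y \<le> a + b" "- y \<le> a + b"
    using assms(1) by (simp_all add: abs_le_iff)
  show "y = y1 + (y - y1)"
    by simp
  have "- a \<le> y1"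
    by (simp add: y1_def)
  moreover have "y1 \<le> a"
    unfolding y1_def using assms(2) by (intro le_supI inf_le2) (metis neg_le_0_iff_le order_trans)
  ultimately show "\<bar>y1\<bar> \<le> a"
    by (intro abs_leI) (simp_all add: minus_le_iff)
  have "y - b \<le> inf y a"
    using y assms(3) by (intro le_infI) (simp_all add: diff_le_eq)
  then have "y - b \<le> y1"
    unfolding y1_def using le_supI2 by blast
  moreover have "y1 \<le> y + b"
  proof -
    have "- a \<le> y + b"
      using add_right_mono[OF y(2), of "y - a"] by (simp add: algebra_simps)
    moreover have "inf y a \<le> y + b"
      using assms(3) by (intro order_trans[OF inf_le1]) simp
    ultimately show ?thesis
      by (simp add: y1_def)
  qed
  ultimately show "\<bar>y - y1\<bar> \<le> b"
    by (intro abs_leI) (simp_all add: algebra_simps)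
qed

text \<open>Every element is a difference of two positive ones, so \<open>p\<close> extends by
  differences. Scaling by zero is covered by \<open>p 0 = 0\<close>, which additivity
  forces.\<close>

lemma positive_operator_extension:
  fixes p :: "'e::banach_lattice \<Rightarrow> 'e"
  assumes add: "\<And>x y. 0 \<le> x \<Longrightarrow> 0 \<le> y \<Longrightarrow> p (x + y) = p x + p y"
    and scale: "\<And>c x. 0 < c \<Longrightarrow> 0 \<le> x \<Longrightarrow> p (c *\<^sub>R x) = c *\<^sub>R p x"
    and nonneg: "\<And>x. 0 \<le> x \<Longrightarrow> 0 \<le> p x"
  obtains R where "positive_operator R" "\<And>x. 0 \<le> x \<Longrightarrow> R x = p x"
proof
  define R where "R x = p (pprt x) - p (- nprt x)" for x
  have p0: "p 0 = 0"
    using add[of 0 0] by simp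
  then show R_eq: "R x = p x" if "0 \<le> x" for x
    using that by (simp add: R_def)
  \<comment> \<open>Independence of the chosen difference: adding crosswise turns two
    representations of one element into an equation inside the cone, where \<open>p\<close> is
    additive. Linearity below comes from choosing convenient representations.\<close>
  have R_diff: "R (a - b) = p a - p b" if "0 \<le> a" "0 \<le> b" for a b
  proof -
    define x where "x = a - b"
    have "pprt x + b = a + - nprt x"
      using prts[of x] by (simp add: x_def algebra_simps)
    then have "p (pprt x) + p b = p a + p (- nprt x)"
      using add[of "pprt x" b] add[of a "- nprt x"] that by simp
    then show ?thesis
      by (simp add: R_def x_def algebra_simps)
  qed
  have decomp: "R x = p (pprt x) - p (- nprt x)" "x = pprt x - - nprt x" for x
    using prts[of x] by (simp_all add: R_def)
  have R_minus: "R (- x) = - R x" for x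
    by (simp add: R_def pprt_neg nprt_neg)
  have R_scale: "R (c *\<^sub>R x) = c *\<^sub>R R x" if "0 < c" for c x
  proof -
    have "R (c *\<^sub>R x) = R (c *\<^sub>R pprt x - c *\<^sub>R (- nprt x))"
      using decomp(2)[of x] by (metis scaleR_diff_right)
    also have "\<dots> = p (c *\<^sub>R pprt x) - p (c *\<^sub>R (- nprt x))"
      using that by (intro R_diff scaleR_nonneg_nonneg) simp_all
    also have "\<dots> = c *\<^sub>R p (pprt x) - c *\<^sub>R p (- nprt x)"
      using that scale[of c "pprt x"] scale[of c "- nprt x"] by simp
    finally show ?thesis
      by (simp add: R_def scaleR_diff_right)
  qed
  have "linear R"
  proof (rule linearI)
    fix x y
    have "R (x + y) = R ((pprt x + pprt y) - (- nprt x + - nprt y))"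
      using decomp(2)[of x] decomp(2)[of y] by (metis add_diff_add)
    also have "\<dots> = p (pprt x + pprt y) - p (- nprt x + - nprt y)"
      by (intro R_diff add_nonneg_nonneg) simp_all
    also have "\<dots> = R x + R y"
      using add[of "pprt x" "pprt y"] add[of "- nprt x" "- nprt y"] by (simp add: R_def)
    finally show "R (x + y) = R x + R y" .
  next
    fix c :: real and x
    consider "0 < c" | "c = 0" | "0 < - c"
      by linarith
    then show "R (c *\<^sub>R x) = c *\<^sub>R R x"
    proof cases
      case 3
      then show ?thesis
        using R_scale[of "- c" x] R_minus[of "c *\<^sub>R x"] by simp
    qed (simp_all add: R_scale R_eq p0)
  qed
  then show "positive_operator R"
    using nonneg by (simp add: positive_operator_def R_eq)
qed

text \<open>The Riesz-Kantorovich formula: on the positive cone the modulus of \<open>T\<close> at \<open>x\<close> is the supremum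
  of \<open>T y\<close> over all \<open>y\<close> with \<open>\<bar>y\<bar> \<le> x\<close>.\<close>

lemma dominated_modulus_exists:
  fixes T :: "'e::banach_lattice \<Rightarrow>\<^sub>L 'e"
  assumes "dedekind_complete TYPE('e)" and dom: "operator_le T P" "operator_le (- T) P"
  obtains R where "operator_le T R" "operator_le (- T) R"
    "\<And>S. operator_le T S \<Longrightarrow> operator_le (- T) S \<Longrightarrow> operator_le R S"
proof -
  \<comment> \<open>Used twice: with \<open>P\<close> it bounds the sets whose suprema are taken,
    and with arbitrary \<open>S\<close> it shows that the resulting operator is least.\<close>
  have bound: "T y \<le> S x"
    if S: "operator_le T S" "operator_le (- T) S" and y: "\<bar>y\<bar> \<le> x" for S x y
  proof -
    have "T y \<le> \<bar>T y\<bar>"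
      by (rule abs_ge_self)
    also have "\<dots> \<le> S \<bar>y\<bar>"
      by (rule abs_dominated_apply_le[OF S])
    also have "\<dots> \<le> S x"
      using operator_le_dominated_imp_positive[OF S] y by (rule positive_operator_mono)
    finally show ?thesis .
  qed
  have "\<exists>s. (\<forall>y. \<bar>y\<bar> \<le> x \<longrightarrow> T y \<le> s) \<and> (\<forall>u. (\<forall>y. \<bar>y\<bar> \<le> x \<longrightarrow> T y \<le> u) \<longrightarrow> s \<le> u)"
    if "0 \<le> x" for x
  proof -
    have "T ` {y. \<bar>y\<bar> \<le> x} \<noteq> {}"
      using that by (auto intro: exI[of _ 0])
    moreover have "bdd_above (T ` {y. \<bar>y\<bar> \<le> x})"
      using bound[OF dom] by (intro bdd_aboveI2[of _ _ "P x"]) simp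
    ultimately have "\<exists>s. (\<forall>z\<in>T ` {y. \<bar>y\<bar> \<le> x}. z \<le> s) \<and>
        (\<forall>u. (\<forall>z\<in>T ` {y. \<bar>y\<bar> \<le> x}. z \<le> u) \<longrightarrow> s \<le> u)"
      by (rule assms(1)[unfolded dedekind_complete_def, rule_format])
    then show ?thesis
      by simp
  qed
  then obtain p where p_upper: "\<And>x y. 0 \<le> x \<Longrightarrow> \<bar>y\<bar> \<le> x \<Longrightarrow> T y \<le> p x"
    and p_least: "\<And>x u. 0 \<le> x \<Longrightarrow> (\<And>y. \<bar>y\<bar> \<le> x \<Longrightarrow> T y \<le> u) \<Longrightarrow> p x \<le> u"
    by metis
  have add: "p (a + b) = p a + p b" if ab: "0 \<le> a" "0 \<le> b" for a b
  proof (rule antisym)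
    show "p (a + b) \<le> p a + p b"
    proof (rule p_least)
      fix y assume "\<bar>y\<bar> \<le> a + b"
      then obtain y1 y2 where "y = y1 + y2" "\<bar>y1\<bar> \<le> a" "\<bar>y2\<bar> \<le> b"
        using ab by (rule riesz_decomposition_abs)
      then show "T y \<le> p a + p b"
        using ab p_upper by (simp add: blinfun.add_right add_mono)
    qed (use ab in simp)
    \<comment> \<open>Superadditivity: take the supremum over \<open>y1\<close> with
      \<open>y2\<close> fixed, then over \<open>y2\<close>.\<close>
    have "T y1 + T y2 \<le> p (a + b)" if "\<bar>y1\<bar> \<le> a" "\<bar>y2\<bar> \<le> b" for y1 y2
    proof -
      have "\<bar>y1 + y2\<bar> \<le> a + b"
        using that abs_triangle_ineq add_mono order_trans by blast
      then show ?thesis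
        using ab p_upper[of "a + b" "y1 + y2"] by (simp add: blinfun.add_right)
    qed
    then have "p a \<le> p (a + b) - T y2" if "\<bar>y2\<bar> \<le> b" for y2
      using ab that by (intro p_least) (simp_all add: le_diff_eq)
    then have "p b \<le> p (a + b) - p a"
      using ab by (intro p_least) (simp_all add: le_diff_eq add.commute)
    then show "p a + p b \<le> p (a + b)"
      by (simp add: le_diff_eq add.commute)
  qed
  have scale_le: "p (c *\<^sub>R x) \<le> c *\<^sub>R p x" if "0 < c" "0 \<le> x" for c x
  proof (rule p_least)
    fix y assume y: "\<bar>y\<bar> \<le> c *\<^sub>R x"
    have "\<bar>inverse c *\<^sub>R y\<bar> \<le> x"
      using y scaleR_left_mono[of _ "c *\<^sub>R x" "inverse c"] that
      by (auto simp: abs_le_iff simp flip: scaleR_minus_right)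
    then have "T (inverse c *\<^sub>R y) \<le> p x"
      using that(2) by (rule p_upper[rotated])
    then have "c *\<^sub>R T (inverse c *\<^sub>R y) \<le> c *\<^sub>R p x"
      using that by (intro scaleR_left_mono) simp_all
    then show "T y \<le> c *\<^sub>R p x"
      using that by (simp add: blinfun.scaleR_right)
  qed (use that in \<open>simp add: scaleR_nonneg_nonneg\<close>)
  \<comment> \<open>The reverse inequality is \<open>scale_le\<close> for \<open>inverse c\<close>
    at the point \<open>c *\<^sub>R x\<close>.\<close>
  have scale: "p (c *\<^sub>R x) = c *\<^sub>R p x" if "0 < c" "0 \<le> x" for c x
  proof (rule antisym)
    have "p x \<le> inverse c *\<^sub>R p (c *\<^sub>R x)"
      using scale_le[of "inverse c" "c *\<^sub>R x"] that by (simp add: scaleR_nonneg_nonneg)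
    then have "c *\<^sub>R p x \<le> c *\<^sub>R (inverse c *\<^sub>R p (c *\<^sub>R x))"
      using that by (intro scaleR_left_mono) simp_all
    then show "c *\<^sub>R p x \<le> p (c *\<^sub>R x)"
      using that by simp
  qed (rule scale_le[OF that])
  have nonneg: "0 \<le> p x" if "0 \<le> x" for x
    using p_upper[of x 0] that by simp
  obtain R where R: "positive_operator R" "\<And>x. 0 \<le> x \<Longrightarrow> R x = p x"
    using positive_operator_extension[of p] add scale nonneg by blast
  have R_le: "R x \<le> P x" if "0 \<le> x" for x
    using R(2) p_least[of x "P x"] bound[OF dom] that by simp
  \<comment> \<open>On the cone \<open>R\<close> lies below the bounded operator \<open>P\<close>,
    so \<bar>R x\<bar> \<le> P \<bar>x\<bar> and \<open>norm P\<close> serves as a bound.\<close>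
  have "bounded_linear R"
  proof -
    have "norm (R x) \<le> norm x * norm P" for x
    proof -
      have "R x \<le> R \<bar>x\<bar>" "R (- x) \<le> R \<bar>x\<bar>"
        by (rule positive_operator_mono[OF R(1)], rule abs_ge_self abs_ge_minus_self)+
      moreover have "R (- x) = - R x"
        using R(1) by (simp add: positive_operator_def linear_neg)
      ultimately have "\<bar>R x\<bar> \<le> R \<bar>x\<bar>"
        by (simp add: abs_leI)
      also have "\<dots> \<le> P \<bar>x\<bar>"
        by (rule R_le) simp
      also have "\<dots> \<le> \<bar>P \<bar>x\<bar>\<bar>"
        by (rule abs_ge_self)
      finally have "norm (R x) \<le> norm (P \<bar>x\<bar>)"
        by (rule norm_mono_abs)
      also have "\<dots> \<le> norm x * norm P"
        using norm_blinfun[of P "\<bar>x\<bar>"] by (simp add: mult.commute)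
      finally show ?thesis .
    qed
    then show ?thesis
      using R(1) unfolding positive_operator_def bounded_linear_def bounded_linear_axioms_def
      by blast
  qed
  then obtain Q where Q: "blinfun_apply Q = R"
    using bounded_linear_Blinfun_apply by blast
  show thesis
  proof
    show "operator_le T Q"
      using p_upper by (simp add: operator_le_iff Q R(2))
    \<comment> \<open>The interval is symmetric: for positive \<open>x\<close> it also contains
      \<open>- x\<close>.\<close>
    show "operator_le (- T) Q"
      using p_upper[of _ "- _"] by (auto simp: operator_le_iff Q R(2) blinfun.minus_left blinfun.minus_right)
    show "operator_le Q S" if "operator_le T S" "operator_le (- T) S" for S
      using p_least bound[OF that] by (simp add: operator_le_iff Q R(2))
  qed
qed

section \<open>Modulus and regular norm of a dominated operator\<close>

lemma positive_imp_regular: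
  assumes "positive_operator (blinfun_apply P)"
  shows "P \<in> regular_operators"
proof -
  have "positive_operator (\<lambda>x. 0)"
    by (simp add: positive_operator_def linear_zero)
  then show ?thesis
    using assms unfolding regular_operators_def mem_Collect_eq
    by (intro exI[of _ "blinfun_apply P"] exI[of _ "\<lambda>x. 0"]) simp
qed

text \<open>The definition tests leastness only against regular operators, but all dominating
  operators are positive and hence regular. Antisymmetry of the operator order gives
  uniqueness.\<close>

lemma operator_modulus_eq:
  assumes "operator_le T R" "operator_le (- T) R"
    and least: "\<And>S. operator_le T S \<Longrightarrow> operator_le (- T) S \<Longrightarrow> operator_le R S"
  shows "operator_modulus T = R"
  unfolding operator_modulus_def
proof (rule the_equality)
  show "R \<in> regular_operators \<and> operator_le T R \<and> operator_le (- T) R \<and>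
      (\<forall>S\<in>regular_operators. operator_le T S \<longrightarrow> operator_le (- T) S \<longrightarrow> operator_le R S)"
    using assms positive_imp_regular operator_le_dominated_imp_positive by blast
  then show "Q = R" if "Q \<in> regular_operators \<and> operator_le T Q \<and> operator_le (- T) Q \<and>
      (\<forall>S\<in>regular_operators. operator_le T S \<longrightarrow> operator_le (- T) S \<longrightarrow> operator_le Q S)" for Q
    using that operator_le_antisym by blast
qed

text \<open>The modulus dominates \<open>T\<close>, and \<open>P\<close> dominates the modulus, so
  norm monotonicity under domination applies twice.\<close>

lemma regular_norm_bounds:
  fixes T :: "'e::banach_lattice \<Rightarrow>\<^sub>L 'e"
  assumes "dedekind_complete TYPE('e)" and dom: "operator_le T P" "operator_le (- T) P"
  shows "norm T \<le> regular_norm T" "regular_norm T \<le> norm P"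
proof -
  obtain R where R: "operator_le T R" "operator_le (- T) R"
    "\<And>S. operator_le T S \<Longrightarrow> operator_le (- T) S \<Longrightarrow> operator_le R S"
    using dominated_modulus_exists[OF assms] by blast
  then have eq: "regular_norm T = norm R"
    by (simp add: regular_norm_def operator_modulus_eq)
  show "norm T \<le> regular_norm T"
    unfolding eq by (rule norm_dominated_le[OF R(1,2)])
  have "operator_le (- R) P"
    unfolding operator_le_iff
  proof (intro allI impI)
    fix x :: 'e
    assume "0 \<le> x"
    then have "0 \<le> R x" "0 \<le> P x"
      using operator_le_dominated_imp_positive[OF R(1,2)] operator_le_dominated_imp_positive[OF dom]
      by (simp_all add: positive_operator_def)
    then have "- R x \<le> P x"
      by (metis neg_le_0_iff_le order_trans)
    then show "(- R) x \<le> P x"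
      by (simp add: blinfun.minus_left)
  qed
  then show "regular_norm T \<le> norm P"
    unfolding eq using R(3)[OF dom] by (intro norm_dominated_le)
qed

section \<open>Continuous functions vanishing at infinity\<close>

text \<open>It suffices to enclose each superlevel set in a compact set: by continuity it is closed,
  and a closed subset of a compact set is compact.\<close>

lemma C0I:
  assumes cont: "continuous_map X euclideanreal \<phi>"
    and "\<And>x. x \<notin> topspace X \<Longrightarrow> \<phi> x = 0"
    and comp: "\<And>\<epsilon>. 0 < \<epsilon> \<Longrightarrow>
      \<exists>K. compactin X K \<and> (\<forall>x\<in>topspace X. \<epsilon> \<le> \<bar>\<phi> x\<bar> \<longrightarrow> x \<in> K)"
  shows "\<phi> \<in> C0 X"
proof -
  have "compactin X {x \<in> topspace X. \<epsilon> \<le> \<bar>\<phi> x\<bar>}" if \<epsilon>: "0 < \<epsilon>" for \<epsilon>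
  proof -
    obtain K where "compactin X K" "\<forall>x\<in>topspace X. \<epsilon> \<le> \<bar>\<phi> x\<bar> \<longrightarrow> x \<in> K"
      using comp[OF \<epsilon>] by blast
    moreover have "closedin X {x \<in> topspace X. \<bar>\<phi> x\<bar> \<in> {\<epsilon>..}}"
      by (rule closedin_continuous_map_preimage[OF continuous_map_real_abs[OF cont]]) simp
    ultimately show ?thesis
      by (auto intro: closed_compactin)
  qed
  with assms(1,2) show ?thesis
    by (simp add: C0_def)
qed

lemma
  assumes "\<phi> \<in> C0 X"
  shows C0_continuous: "continuous_map X euclideanreal \<phi>"
    and C0_outside: "x \<notin> topspace X \<Longrightarrow> \<phi> x = 0"
    and C0_compactin: "0 < \<epsilon> \<Longrightarrow> compactin X {x \<in> topspace X. \<epsilon> \<le> \<bar>\<phi> x\<bar>}"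
  using assms by (simp_all add: C0_def)

lemma C0_dominated:
  assumes "\<phi> \<in> C0 X" "continuous_map X euclideanreal \<psi>" "\<And>x. \<bar>\<psi> x\<bar> \<le> c * \<bar>\<phi> x\<bar>" "0 < c"
  shows "\<psi> \<in> C0 X"
proof (rule C0I[OF assms(2)])
  show "\<psi> x = 0" if "x \<notin> topspace X" for x
    using assms(3)[of x] C0_outside[OF assms(1) that] by simp
  fix \<epsilon> :: real
  assume "0 < \<epsilon>"
  then have "compactin X {x \<in> topspace X. \<epsilon> / c \<le> \<bar>\<phi> x\<bar>}"
    using assms by (intro C0_compactin) simp_all
  moreover have "\<epsilon> / c \<le> \<bar>\<phi> x\<bar>" if "\<epsilon> \<le> \<bar>\<psi> x\<bar>" for x
    using that assms(3)[of x] assms(4) by (simp add: field_simps)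
  ultimately show "\<exists>K. compactin X K \<and> (\<forall>x\<in>topspace X. \<epsilon> \<le> \<bar>\<psi> x\<bar> \<longrightarrow> x \<in> K)"
    by blast
qed

lemma C0_zero: "(\<lambda>x. 0) \<in> C0 X"
  by (rule C0I) auto

lemma C0_abs: "\<phi> \<in> C0 X \<Longrightarrow> (\<lambda>x. \<bar>\<phi> x\<bar>) \<in> C0 X"
  by (rule C0_dominated[of \<phi> X _ 1]) (auto intro: continuous_map_real_abs C0_continuous)

lemma C0_scale: "\<phi> \<in> C0 X \<Longrightarrow> (\<lambda>x. c * \<phi> x) \<in> C0 X"
  \<comment> \<open>Adding one keeps the factor strictly positive when \<open>c = 0\<close>.\<close>
  by (rule C0_dominated[of \<phi> X _ "\<bar>c\<bar> + 1"])
    (auto intro: continuous_map_real_mult_left C0_continuous simp: abs_mult mult_right_mono)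

lemma C0_uminus: "\<phi> \<in> C0 X \<Longrightarrow> (\<lambda>x. - \<phi> x) \<in> C0 X"
  using C0_scale[of \<phi> X "-1"] by simp

lemma C0_add:
  assumes "\<phi> \<in> C0 X" "\<psi> \<in> C0 X"
  shows "(\<lambda>x. \<phi> x + \<psi> x) \<in> C0 X"
proof (rule C0I)
  show "continuous_map X euclideanreal (\<lambda>x. \<phi> x + \<psi> x)"
    using assms by (intro continuous_map_add C0_continuous)
  show "\<phi> x + \<psi> x = 0" if "x \<notin> topspace X" for x
    using that assms by (simp add: C0_outside)
  fix \<epsilon> :: real
  assume "0 < \<epsilon>"
  then have "compactin X ({x \<in> topspace X. \<epsilon> / 2 \<le> \<bar>\<phi> x\<bar>} \<union> {x \<in> topspace X. \<epsilon> / 2 \<le> \<bar>\<psi> x\<bar>})"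
    using assms by (intro compactin_Un C0_compactin) simp_all
  moreover have "\<epsilon> / 2 \<le> \<bar>\<phi> x\<bar> \<or> \<epsilon> / 2 \<le> \<bar>\<psi> x\<bar>" if "\<epsilon> \<le> \<bar>\<phi> x + \<psi> x\<bar>" for x
    using that by linarith
  ultimately show "\<exists>K. compactin X K \<and> (\<forall>x\<in>topspace X. \<epsilon> \<le> \<bar>\<phi> x + \<psi> x\<bar> \<longrightarrow> x \<in> K)"
    by (metis (mono_tags, lifting) UnCI mem_Collect_eq)
qed

lemma C0_diff: "\<phi> \<in> C0 X \<Longrightarrow> \<psi> \<in> C0 X \<Longrightarrow> (\<lambda>x. \<phi> x - \<psi> x) \<in> C0 X"
  using C0_add[OF _ C0_uminus, of \<phi> X \<psi>] by simp

lemma C0_sum: "(\<And>i. i \<in> I \<Longrightarrow> f i \<in> C0 X) \<Longrightarrow> (\<lambda>x. \<Sum>i\<in>I. f i x) \<in> C0 X"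
  by (induction I rule: infinite_finite_induct) (simp_all add: C0_zero C0_add)

text \<open>This is the completeness behind the gliding hump: it keeps the sum of the humps in
  \<open>C0 X\<close>.\<close>

lemma C0_uniform_limit:
  assumes f: "\<And>n. f n \<in> C0 X" and lim: "uniform_limit UNIV f \<phi> sequentially"
  shows "\<phi> \<in> C0 X"
proof (rule C0I)
  have close: "\<forall>\<^sub>F n in sequentially. \<forall>x\<in>topspace X. dist (f n x) (\<phi> x) < \<epsilon>" if "0 < \<epsilon>" for \<epsilon>
    using uniform_limitD[OF lim that] by (rule eventually_mono) simp
  \<comment> \<open>\<open>Met_TC\<close> is the metric space given by the type's own distance; for
    the reals its topology is the euclidean one.\<close>
  have "continuous_map X Met_TC.mtopology \<phi>"
    using f close
    by (intro Met_TC.continuous_map_uniform_limit_alt[where F = sequentially and f = f])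
      (simp_all add: C0_continuous)
  then show "continuous_map X euclideanreal \<phi>"
    by simp
  show "\<phi> x = 0" if "x \<notin> topspace X" for x
    using tendsto_uniform_limitI[OF lim, of x] C0_outside[OF f that] by (simp add: LIMSEQ_const_iff)
  fix \<epsilon> :: real
  assume "0 < \<epsilon>"
  then obtain n where n: "\<forall>x\<in>topspace X. dist (f n x) (\<phi> x) < \<epsilon> / 2"
    using close[of "\<epsilon> / 2"] by (auto simp: eventually_sequentially)
  have "compactin X {x \<in> topspace X. \<epsilon> / 2 \<le> \<bar>f n x\<bar>}"
    using f \<open>0 < \<epsilon>\<close> by (intro C0_compactin) simp_all
  moreover have "\<epsilon> / 2 \<le> \<bar>f n x\<bar>" if "x \<in> topspace X" "\<epsilon> \<le> \<bar>\<phi> x\<bar>" for x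
    using bspec[OF n that(1)] that(2) unfolding dist_real_def by linarith
  ultimately show "\<exists>K. compactin X K \<and> (\<forall>x\<in>topspace X. \<epsilon> \<le> \<bar>\<phi> x\<bar> \<longrightarrow> x \<in> K)"
    by blast
qed

section \<open>The sup norm on \<open>C0 X\<close>\<close>

lemma C0_bdd_above:
  assumes "\<phi> \<in> C0 X"
  shows "bdd_above (range (\<lambda>x. \<bar>\<phi> x\<bar>))"
proof -
  \<comment> \<open>Any positive level would do: \<phi> is bounded on the compact \<open>K\<close>
    by compactness of the image, and by the level elsewhere.\<close>
  define K where "K = {x \<in> topspace X. 1 \<le> \<bar>\<phi> x\<bar>}"
  have "compactin euclideanreal (\<phi> ` K)"
    unfolding K_def using assms
    by (intro image_compactin[OF C0_compactin C0_continuous]) simp_all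
  then have "bounded (\<phi> ` K)"
    by (simp add: compact_imp_bounded)
  then obtain M where M: "\<And>x. x \<in> K \<Longrightarrow> \<bar>\<phi> x\<bar> \<le> M"
    by (auto simp: bounded_iff)
  have "\<bar>\<phi> x\<bar> \<le> max M 1" for x
  proof (cases "x \<in> K")
    case True
    then show ?thesis
      using M by (simp add: le_max_iff_disj)
  next
    case False
    then show ?thesis
      using C0_outside[OF assms, of x] by (cases "x \<in> topspace X") (auto simp: K_def le_max_iff_disj)
  qed
  then show ?thesis
    by (intro bdd_aboveI2)
qed

lemma abs_le_sup_norm: "\<phi> \<in> C0 X \<Longrightarrow> \<bar>\<phi> x\<bar> \<le> sup_norm \<phi>"
  unfolding sup_norm_def by (intro cSUP_upper C0_bdd_above) simp_all

lemma sup_norm_nonneg: "\<phi> \<in> C0 X \<Longrightarrow> 0 \<le> sup_norm \<phi>"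
  \<comment> \<open>An arbitrary point of the ambient type, available even when \<open>X\<close> is
    empty.\<close>
  using abs_le_sup_norm[of \<phi> X undefined] by linarith

lemma sup_norm_le: "(\<And>x. \<bar>\<phi> x\<bar> \<le> c) \<Longrightarrow> sup_norm \<phi> \<le> c"
  unfolding sup_norm_def by (intro cSUP_least) simp_all

lemma sup_norm_abs [simp]: "sup_norm (\<lambda>x. \<bar>\<phi> x\<bar>) = sup_norm \<phi>"
  by (simp add: sup_norm_def)

text \<open>Weakens an estimate by \<open>sup_norm \<phi>\<close> to the one by the two parts;
  pointwise, \<bar>\<phi>\<bar> is the sum of the parts.\<close>

lemma sup_norm_le_parts:
  assumes "\<phi> \<in> C0 X"
  shows "sup_norm \<phi> \<le> sup_norm (pos_part \<phi>) + sup_norm (neg_part \<phi>)"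
proof (rule sup_norm_le)
  fix x
  have "pos_part \<phi> \<in> C0 X" "neg_part \<phi> \<in> C0 X"
    using C0_continuous[OF assms] C0_continuous[OF C0_uminus[OF assms]]
    by (auto simp: pos_part_def neg_part_def
        intro!: C0_dominated[OF assms, of _ 1] continuous_map_real_max)
  then have "\<bar>pos_part \<phi> x\<bar> \<le> sup_norm (pos_part \<phi>)" "\<bar>neg_part \<phi> x\<bar> \<le> sup_norm (neg_part \<phi>)"
    by (simp_all add: abs_le_sup_norm)
  then show "\<bar>\<phi> x\<bar> \<le> sup_norm (pos_part \<phi>) + sup_norm (neg_part \<phi>)"
    unfolding pos_part_def neg_part_def by linarith
qed

lemma one_fun_C0:
  assumes "compact_space X"
  shows "one_fun X \<in> C0 X"
proof -
  have "continuous_map X euclideanreal (one_fun X)"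
    by (rule continuous_map_eq[of _ _ "\<lambda>_. 1"]) simp_all
  then show ?thesis
    using assms by (simp add: C0_compact_space)
qed

section \<open>Norms of positive representations\<close>

lemma positive_representation_add:
  "positive_representation X \<pi> \<Longrightarrow> \<phi> \<in> C0 X \<Longrightarrow> \<psi> \<in> C0 X \<Longrightarrow>
    \<pi> (\<lambda>x. \<phi> x + \<psi> x) = \<pi> \<phi> + \<pi> \<psi>"
  by (simp add: positive_representation_def)

lemma positive_representation_scale:
  "positive_representation X \<pi> \<Longrightarrow> \<phi> \<in> C0 X \<Longrightarrow> \<pi> (\<lambda>x. c * \<phi> x) = c *\<^sub>R \<pi> \<phi>"
  by (simp add: positive_representation_def)

lemma positive_representation_mono:
  assumes "positive_representation X \<pi>" "\<phi> \<in> C0 X" "\<psi> \<in> C0 X" "\<And>x. \<phi> x \<le> \<psi> x"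
  shows "operator_le (\<pi> \<phi>) (\<pi> \<psi>)"
proof -
  have diff: "(\<lambda>x. \<psi> x - \<phi> x) \<in> C0 X"
    using assms by (intro C0_diff)
  have "\<pi> (\<lambda>x. (\<psi> x - \<phi> x) + \<phi> x) = \<pi> (\<lambda>x. \<psi> x - \<phi> x) + \<pi> \<phi>"
    by (rule positive_representation_add[OF assms(1) diff assms(2)])
  then have "\<pi> \<psi> - \<pi> \<phi> = \<pi> (\<lambda>x. \<psi> x - \<phi> x)"
    by simp
  moreover have "positive_operator (\<pi> (\<lambda>x. \<psi> x - \<phi> x))"
    using assms(1,4) diff by (simp add: positive_representation_def)
  ultimately show ?thesis
    by (simp add: operator_le_def)
qed

text \<open>The bridge to the operator estimates above: pointwise domination of functions becomes
  domination of operators.\<close>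

lemma positive_representation_dominated:
  assumes "positive_representation X \<pi>" "\<phi> \<in> C0 X" "\<psi> \<in> C0 X" "\<And>x. \<bar>\<phi> x\<bar> \<le> \<psi> x"
  shows "operator_le (\<pi> \<phi>) (\<pi> \<psi>)" "operator_le (- \<pi> \<phi>) (\<pi> \<psi>)"
proof -
  show "operator_le (\<pi> \<phi>) (\<pi> \<psi>)"
    using assms by (intro positive_representation_mono) (auto simp: abs_le_iff)
  have "\<pi> (\<lambda>x. - 1 * \<phi> x) = - 1 *\<^sub>R \<pi> \<phi>"
    by (rule positive_representation_scale[OF assms(1,2)])
  moreover have "operator_le (\<pi> (\<lambda>x. - 1 * \<phi> x)) (\<pi> \<psi>)"
    using assms by (intro positive_representation_mono C0_scale) (auto simp: abs_le_iff)
  ultimately show "operator_le (- \<pi> \<phi>) (\<pi> \<psi>)"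
    by simp
qed

text \<open>Gliding hump: if \<open>\<pi>\<close> were unbounded on the positive cone, there would be \<open>\<psi> n \<ge> 0\<close> with
  sup norm at most \<open>2\<^sup>-\<^sup>n\<close> and \<open>norm (\<pi> (\<psi> n)) > 2\<^sup>n\<close>, and \<open>\<pi>\<close> of their sum would dominate all
  \<open>\<pi> (\<psi> n)\<close>.\<close>

lemma positive_representation_bounded_cone:
  assumes \<pi>: "positive_representation X \<pi>"
  obtains M where "\<And>\<phi>. \<phi> \<in> C0 X \<Longrightarrow> (\<And>x. 0 \<le> \<phi> x) \<Longrightarrow> norm (\<pi> \<phi>) \<le> M * sup_norm \<phi>"
proof (rule ccontr)
  assume "\<not> thesis"
  then have "\<exists>\<phi>. \<phi> \<in> C0 X \<and> (\<forall>x. 0 \<le> \<phi> x) \<and> M * sup_norm \<phi> < norm (\<pi> \<phi>)" for M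
    using that[of M] by (meson not_le)
  \<comment> \<open>Of \<open>4 ^ n = 2 ^ n * 2 ^ n\<close>, one factor pays for summability of the
    humps and the other for growth of their images.\<close>
  then have "\<exists>f. \<forall>n::nat. f n \<in> C0 X \<and> (\<forall>x. 0 \<le> f n x) \<and> 4 ^ n * sup_norm (f n) < norm (\<pi> (f n))"
    by (intro choice) blast
  then obtain f where f: "\<And>n. f n \<in> C0 X" "\<And>n x. 0 \<le> f n x"
    and f_large: "\<And>n::nat. 4 ^ n * sup_norm (f n) < norm (\<pi> (f n))"
    by blast
  note scale = positive_representation_scale[OF \<pi>]
  \<comment> \<open>Needed for normalising. If the sup norm vanished, \<open>f n\<close> would be
    zero times itself, so homogeneity would give \<open>\<pi> (f n) = 0\<close>, against the strict
    inequality.\<close>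
  have pos: "0 < sup_norm (f n)" for n
  proof (rule ccontr)
    assume "\<not> 0 < sup_norm (f n)"
    then have 0: "sup_norm (f n) = 0"
      using sup_norm_nonneg[OF f(1)[of n]] by simp
    then have "f n = (\<lambda>x. 0 * f n x)"
      using abs_le_sup_norm[OF f(1)[of n]] by auto
    then have "\<pi> (f n) = 0"
      using scale[OF f(1)[of n], of 0] by simp
    then show False
      using f_large[of n] 0 by simp
  qed
  define \<psi> where "\<psi> n = (\<lambda>x. inverse (2 ^ n * sup_norm (f n)) * f n x)" for n :: nat
  have \<psi>: "\<psi> n \<in> C0 X" "0 \<le> \<psi> n x" for n x
    using f pos[of n] by (simp_all add: \<psi>_def C0_scale)
  have \<psi>_le: "\<psi> n x \<le> (1 / 2) ^ n" for n x
    using abs_le_sup_norm[OF f(1), of n x] f(2)[of n x] pos[of n]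
    by (simp add: \<psi>_def field_simps)
  have \<psi>_large: "2 ^ n < norm (\<pi> (\<psi> n))" for n
  proof -
    have "(2::real) ^ n * (2 ^ n * sup_norm (f n)) < norm (\<pi> (f n))"
      using f_large[of n] by (simp flip: mult.assoc power_mult_distrib)
    moreover have "norm (\<pi> (\<psi> n)) = norm (\<pi> (f n)) / (2 ^ n * sup_norm (f n))"
      using pos[of n] by (simp only: \<psi>_def scale[OF f(1)]) (simp add: field_simps)
    ultimately show ?thesis
      using pos[of n] by (simp add: less_divide_eq)
  qed
  define \<Phi> where "\<Phi> x = (\<Sum>n. \<psi> n x)" for x
  have summable: "summable (\<lambda>n. (1 / 2 :: real) ^ n)"
    by (rule summable_geometric) simp
  have "uniform_limit UNIV (\<lambda>n x. \<Sum>i<n. \<psi> i x) \<Phi> sequentially"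
    unfolding \<Phi>_def using \<psi>(2) \<psi>_le by (intro Weierstrass_m_test[OF _ summable]) simp
  then have \<Phi>: "\<Phi> \<in> C0 X"
    by (rule C0_uniform_limit[rotated]) (rule C0_sum[OF \<psi>(1)])
  \<comment> \<open>All terms are nonnegative, so the sum dominates each of them.\<close>
  have le_\<Phi>: "\<psi> n x \<le> \<Phi> x" for n x
  proof -
    have "summable (\<lambda>n. \<psi> n x)"
      using \<psi>(2) \<psi>_le by (intro summable_comparison_test[OF _ summable]) simp
    then show ?thesis
      using sum_le_suminf[of "\<lambda>n. \<psi> n x" "{n}"] \<psi>(2) by (simp add: \<Phi>_def)
  qed
  have "2 ^ n < norm (\<pi> \<Phi>)" for n
  proof -
    have "norm (\<pi> (\<psi> n)) \<le> norm (\<pi> \<Phi>)"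
      using le_\<Phi> \<psi>(2)
      by (intro norm_dominated_le positive_representation_dominated[OF \<pi> \<psi>(1) \<Phi>]) simp_all
    then show ?thesis
      using \<psi>_large[of n] by linarith
  qed
  moreover obtain n where "norm (\<pi> \<Phi>) < 2 ^ n"
    using real_arch_pow[of 2] by auto
  ultimately show False
    using less_asym by blast
qed

lemma positive_representation_norm_le_abs:
  assumes "positive_representation X \<pi>" "\<phi> \<in> C0 X"
  shows "norm (\<pi> \<phi>) \<le> norm (\<pi> (\<lambda>x. \<bar>\<phi> x\<bar>))"
  using assms by (intro norm_dominated_le positive_representation_dominated[OF assms C0_abs]) simp_all

lemma positive_representation_regular_norm:
  fixes \<pi> :: "('x \<Rightarrow> real) \<Rightarrow> ('e::banach_lattice \<Rightarrow>\<^sub>L 'e)"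
  assumes "positive_representation X \<pi>" "\<phi> \<in> C0 X" "dedekind_complete TYPE('e)"
  shows "norm (\<pi> \<phi>) \<le> regular_norm (\<pi> \<phi>)" "regular_norm (\<pi> \<phi>) \<le> norm (\<pi> (\<lambda>x. \<bar>\<phi> x\<bar>))"
  by (rule regular_norm_bounds[OF assms(3)
      positive_representation_dominated[OF assms(1,2) C0_abs[OF assms(2)]]], simp_all)+

lemma positive_representation_abs_le_one:
  assumes \<pi>: "positive_representation X \<pi>" and \<phi>: "\<phi> \<in> C0 X" and "compact_space X"
  shows "norm (\<pi> (\<lambda>x. \<bar>\<phi> x\<bar>)) \<le> norm (\<pi> (one_fun X)) * sup_norm \<phi>"
proof -
  have one: "one_fun X \<in> C0 X"
    using assms by (simp add: one_fun_C0)
  \<comment> \<open>Outside \<open>topspace X\<close> both sides are zero.\<close>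
  have "\<bar>\<phi> x\<bar> \<le> sup_norm \<phi> * one_fun X x" for x
    using abs_le_sup_norm[OF \<phi>, of x] C0_outside[OF \<phi>, of x] by (simp add: indicator_def)
  then have "norm (\<pi> (\<lambda>x. \<bar>\<phi> x\<bar>)) \<le> norm (\<pi> (\<lambda>x. sup_norm \<phi> * one_fun X x))"
    by (intro norm_dominated_le positive_representation_dominated[OF \<pi> C0_abs[OF \<phi>] C0_scale[OF one]])
      simp_all
  also have "\<pi> (\<lambda>x. sup_norm \<phi> * one_fun X x) = sup_norm \<phi> *\<^sub>R \<pi> (one_fun X)"
    by (rule positive_representation_scale[OF \<pi> one])
  finally show ?thesis
    using sup_norm_nonneg[OF \<phi>] by (simp add: mult.commute)
qed

section \<open>Norms of maps on \<open>C0 X\<close>, and the theorem\<close>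

lemma bounded_map_upper:
  assumes "bounded_map \<nu> X \<pi>" "\<phi> \<in> C0 X" "sup_norm \<phi> \<le> 1"
  shows "\<nu> (\<pi> \<phi>) \<le> map_norm \<nu> X \<pi>"
proof -
  obtain M where M: "\<And>\<phi>. \<phi> \<in> C0 X \<Longrightarrow> \<nu> (\<pi> \<phi>) \<le> M * sup_norm \<phi>"
    using assms(1) by (auto simp: bounded_map_def)
  \<comment> \<open>The sign of \<open>M\<close> is unknown, hence the absolute value.\<close>
  have "\<nu> (\<pi> \<psi>) \<le> \<bar>M\<bar>" if "\<psi> \<in> C0 X" "sup_norm \<psi> \<le> 1" for \<psi>
  proof -
    have "M * sup_norm \<psi> \<le> \<bar>M\<bar> * 1"
      using that sup_norm_nonneg by (intro mult_mono) auto
    then show ?thesis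
      using M[OF that(1)] by simp
  qed
  then have "bdd_above ((\<lambda>\<phi>. \<nu> (\<pi> \<phi>)) ` {\<phi> \<in> C0 X. sup_norm \<phi> \<le> 1})"
    by (intro bdd_aboveI2[of _ _ "\<bar>M\<bar>"]) simp
  then show ?thesis
    unfolding map_norm_def using assms by (intro cSUP_upper) simp_all
qed

lemma map_norm_least:
  assumes "\<And>\<phi>. \<phi> \<in> C0 X \<Longrightarrow> sup_norm \<phi> \<le> 1 \<Longrightarrow> \<nu> (\<pi> \<phi>) \<le> c"
  shows "map_norm \<nu> X \<pi> \<le> c"
proof -
  \<comment> \<open>The unit ball must be nonempty for \<open>cSUP_least\<close>.\<close>
  have "(\<lambda>x. 0) \<in> {\<phi> \<in> C0 X. sup_norm \<phi> \<le> 1}"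
    by (simp add: C0_zero sup_norm_le)
  then show ?thesis
    unfolding map_norm_def using assms by (intro cSUP_least) auto
qed

theorem proposition5p1:
  fixes X :: "'x topology"
    and \<pi> :: "('x \<Rightarrow> real) \<Rightarrow> ('e::banach_lattice \<Rightarrow>\<^sub>L 'e)"
  assumes "locally_compact_space X"
    and "Hausdorff_space X"
    and "positive_representation X \<pi>"
    and "\<forall>\<phi>\<in>C0 X. \<pi> \<phi> \<in> regular_operators"
  shows
    "(compact_space X \<longrightarrow>
        (\<forall>\<phi>\<in>C0 X. norm (\<pi> \<phi>)
           \<le> norm (\<pi> (one_fun X)) * (sup_norm (pos_part \<phi>) + sup_norm (neg_part \<phi>))) \<and>
        (bounded_map norm X \<pi> \<and> map_norm norm X \<pi> \<le> 2 * norm (\<pi> (one_fun X)))) \<and>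
     (dedekind_complete TYPE('e) \<longrightarrow>
        bounded_map norm X \<pi> \<and> bounded_map regular_norm X \<pi> \<and>
        map_norm norm X \<pi> \<le> map_norm regular_norm X \<pi>) \<and>
     (compact_space X \<and> dedekind_complete TYPE('e) \<longrightarrow>
        bounded_map norm X \<pi> \<and> bounded_map regular_norm X \<pi> \<and>
        map_norm norm X \<pi> = map_norm regular_norm X \<pi> \<and>
        map_norm regular_norm X \<pi> = norm (\<pi> (one_fun X)))"
proof -
  note \<pi> = assms(3)
  let ?n = "norm (\<pi> (one_fun X))"
  obtain M where M: "\<And>\<phi>. \<phi> \<in> C0 X \<Longrightarrow> (\<And>x. 0 \<le> \<phi> x) \<Longrightarrow> norm (\<pi> \<phi>) \<le> M * sup_norm \<phi>"
    using positive_representation_bounded_cone[OF \<pi>] by blast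
  have M_abs: "norm (\<pi> (\<lambda>x. \<bar>\<phi> x\<bar>)) \<le> M * sup_norm \<phi>" if "\<phi> \<in> C0 X" for \<phi>
    using M[OF C0_abs[OF that]] by simp
  have bdd: "bounded_map norm X \<pi>"
    unfolding bounded_map_def
    using positive_representation_norm_le_abs[OF \<pi>] M_abs order_trans by blast
  have le_one: "norm (\<pi> \<phi>) \<le> ?n * sup_norm \<phi>" if "compact_space X" "\<phi> \<in> C0 X" for \<phi>
    using positive_representation_norm_le_abs[OF \<pi> that(2)]
      positive_representation_abs_le_one[OF \<pi> that(2,1)] by linarith
  have parts: "norm (\<pi> \<phi>) \<le> ?n * (sup_norm (pos_part \<phi>) + sup_norm (neg_part \<phi>))"
    if "compact_space X" "\<phi> \<in> C0 X" for \<phi>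
    using le_one[OF that] mult_left_mono[OF sup_norm_le_parts[OF that(2)], of ?n] by simp
  \<comment> \<open>\<open>le_one\<close> already bounds the values on the unit ball by
    \<open>?n\<close>; doubling only weakens this.\<close>
  have unit: "map_norm norm X \<pi> \<le> 2 * ?n" if "compact_space X"
  proof (rule map_norm_least)
    fix \<phi> assume \<phi>: "\<phi> \<in> C0 X" "sup_norm \<phi> \<le> 1"
    have "?n * sup_norm \<phi> \<le> ?n"
      using \<phi>(2) by (simp add: mult_left_le)
    then show "norm (\<pi> \<phi>) \<le> 2 * ?n"
      using le_one[OF that \<phi>(1)] norm_ge_zero[of "\<pi> (one_fun X)"] by linarith
  qed
  have rbdd: "bounded_map regular_norm X \<pi>" if "dedekind_complete TYPE('e)"
    unfolding bounded_map_def
    using positive_representation_regular_norm(2)[OF \<pi> _ that] M_abs order_trans by blast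
  \<comment> \<open>Compare values on the unit ball; \<open>rbdd\<close> ensures that the right-hand
    supremum really is an upper bound.\<close>
  have le_regular: "map_norm norm X \<pi> \<le> map_norm regular_norm X \<pi>" if "dedekind_complete TYPE('e)"
    using positive_representation_regular_norm(1)[OF \<pi> _ that] bounded_map_upper[OF rbdd[OF that]]
    by (intro map_norm_least) (blast intro: order_trans)
  have regular_le: "map_norm regular_norm X \<pi> \<le> ?n"
    if "compact_space X" "dedekind_complete TYPE('e)"
  proof (rule map_norm_least)
    fix \<phi> assume \<phi>: "\<phi> \<in> C0 X" "sup_norm \<phi> \<le> 1"
    have "?n * sup_norm \<phi> \<le> ?n"
      using \<phi>(2) by (simp add: mult_left_le)
    then show "regular_norm (\<pi> \<phi>) \<le> ?n"
      using positive_representation_regular_norm(2)[OF \<pi> \<phi>(1) that(2)]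
        positive_representation_abs_le_one[OF \<pi> \<phi>(1) that(1)] by linarith
  qed
  \<comment> \<open>The constant one lies in the unit ball, also when \<open>X\<close> is empty.
    This closes the cycle of inequalities through \<open>le_regular\<close> and
    \<open>regular_le\<close>, so all three quantities agree.\<close>
  have one_le: "?n \<le> map_norm norm X \<pi>" if "compact_space X"
    using bdd one_fun_C0[OF that] by (intro bounded_map_upper sup_norm_le) (simp_all add: indicator_abs_le_1)
  show ?thesis
    using bdd parts unit rbdd le_regular regular_le one_le by (auto intro: antisym order_trans)
qed

end
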